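(* Let $\mathbf{Q}$ be a quantale, $\mathbf{M}$ and $\mathbf{N}$ be $\mathbf{Q}$-modules, and $f:\mathbf{M}\to\mathbf{N}$ a $\mathbf{Q}$-module homomorphism with residual $f_*:N\to M$. Then $f_*\circ f$ is a nucleus on $\mathbf{M}$. Conversely, if $\gamma$ is a nucleus on $\mathbf{M}$, then $M_\gamma=\gamma[M]$, with the join $\vee_\gamma=\gamma\circ\vee$ (i.e. the join of a family in $M_\gamma$ is $\gamma$ of its join in $\mathbf{M}$), the external product $\star_\gamma=\gamma\circ\star$ (i.e. $q\star_\gamma m=\gamma(q\star m)$) and the bottom element $\bot_\gamma=\gamma(\bot)$, is a $\mathbf{Q}$-module, denoted $\mathbf{M}_\gamma$, and there exists a $\mathbf{Q}$-module homomorphism $f_\gamma:\mathbf{M}\to\mathbf{M}_\gamma$ such that $(f_\gamma)_*\circ f_\gamma=\gamma$.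
   Context: A sup-lattice is a poset with arbitrary joins. A quantale $\mathbf{Q}=\langle Q,\vee,\cdot,\bot,e\rangle$ is a sup-lattice with a monoid structure $\langle Q,\cdot,e\rangle$ whose product distributes over arbitrary joins in both arguments. A left $\mathbf{Q}$-module is a sup-lattice $\mathbf{M}$ with a scalar multiplication $\star:Q\times M\to M$ preserving arbitrary joins in each argument and satisfying $(q_1q_2)\star m=q_1\star(q_2\star m)$ and $e\star m=m$; right modules are analogous. "$\mathbf{Q}$-module" means consistently left or consistently right module; left notation is used. Homomorphisms preserve arbitrary joins and scalar multiplication. The residual of a join-preserving map $f:M\to N$ is $f_*(n)=\bigvee\{m\in M\mid f(m)\le n\}$, so $f(m)\le n\iff m\le f_*(n)$. A nucleus (structural closure operator) on $\mathbf{M}$ is a map $\gamma:M\to M$ that is order preserving, extensive ($m\le\gamma(m)$), idempotent, and satisfies $q\star\gamma(m)\le\gamma(q\star m)$ for all $q\in Q$, $m\in M$. *)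

theory Defs
  imports "HOL-Algebra.Group"
begin

locale sup_lattice = partial_order L for L (structure) +
  assumes sup_exists: "A \<subseteq> carrier L \<Longrightarrow> \<exists>s. least L s (Upper L A)"

text \<open>The joins and the bottom of a sup-lattice are the operations \<^const>\<open>Lattice.sup\<close> and
  \<^const>\<open>Order.bottom\<close> derived from its order. In the distributivity and preservation laws
  below the family \<open>A\<close> may be empty, so these laws include preservation of the bottom.\<close>

record 'q quantale = "'q gorder" +
  qmult :: "'q \<Rightarrow> 'q \<Rightarrow> 'q" (infixl \<open>\<cdot>\<index>\<close> 70)
  qunit :: 'q

definition mult_monoid :: "('q, 'a) quantale_scheme \<Rightarrow> 'q monoid" where
  "mult_monoid Q = \<lparr>carrier = carrier Q, monoid.mult = qmult Q, one = qunit Q\<rparr>"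

locale quantale = sup_lattice Q for Q (structure) +
  assumes monoid: "monoid (mult_monoid Q)"
    and sup_mult: "\<lbrakk>A \<subseteq> carrier Q; b \<in> carrier Q\<rbrakk> \<Longrightarrow> (\<Squnion>A) \<cdot> b = \<Squnion>((\<lambda>a. a \<cdot> b) ` A)"
    and mult_sup: "\<lbrakk>A \<subseteq> carrier Q; b \<in> carrier Q\<rbrakk> \<Longrightarrow> b \<cdot> (\<Squnion>A) = \<Squnion>((\<lambda>a. b \<cdot> a) ` A)"

text \<open>The scalar is always the first argument of \<open>smult\<close>; for a right module,
  \<open>smult M q m\<close> stands for the product of \<open>m\<close> by \<open>q\<close> on the right.\<close>

record ('q, 'm) qmodule = "'m gorder" +
  smult :: "'q \<Rightarrow> 'm \<Rightarrow> 'm" (infixr \<open>\<star>\<index>\<close> 75)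

locale quantale_action = Q: quantale Q + M: sup_lattice M
  for Q :: "('q, 'a) quantale_scheme" (structure)
    and M :: "('q, 'm, 'b) qmodule_scheme" (structure) +
  assumes smult_closed:
      "\<lbrakk>q \<in> carrier Q; m \<in> carrier M\<rbrakk> \<Longrightarrow> q \<star>\<^bsub>M\<^esub> m \<in> carrier M"
    and sup_smult:
      "\<lbrakk>A \<subseteq> carrier Q; m \<in> carrier M\<rbrakk>
        \<Longrightarrow> (\<Squnion>\<^bsub>Q\<^esub>A) \<star>\<^bsub>M\<^esub> m = \<Squnion>\<^bsub>M\<^esub>((\<lambda>q. q \<star>\<^bsub>M\<^esub> m) ` A)"
    and smult_sup:
      "\<lbrakk>q \<in> carrier Q; B \<subseteq> carrier M\<rbrakk>
        \<Longrightarrow> q \<star>\<^bsub>M\<^esub> (\<Squnion>\<^bsub>M\<^esub>B) = \<Squnion>\<^bsub>M\<^esub>((\<lambda>m. q \<star>\<^bsub>M\<^esub> m) ` B)"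
    and smult_unit: "m \<in> carrier M \<Longrightarrow> qunit Q \<star>\<^bsub>M\<^esub> m = m"

locale left_quantale_module = quantale_action +
  assumes smult_assoc:
    "\<lbrakk>p \<in> carrier Q; q \<in> carrier Q; m \<in> carrier M\<rbrakk>
      \<Longrightarrow> (p \<cdot>\<^bsub>Q\<^esub> q) \<star>\<^bsub>M\<^esub> m = p \<star>\<^bsub>M\<^esub> (q \<star>\<^bsub>M\<^esub> m)"

locale right_quantale_module = quantale_action +
  assumes smult_assoc:
    "\<lbrakk>p \<in> carrier Q; q \<in> carrier Q; m \<in> carrier M\<rbrakk>
      \<Longrightarrow> (p \<cdot>\<^bsub>Q\<^esub> q) \<star>\<^bsub>M\<^esub> m = q \<star>\<^bsub>M\<^esub> (p \<star>\<^bsub>M\<^esub> m)"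

datatype side = Left_Side | Right_Side

definition quantale_module ::
    "side \<Rightarrow> ('q, 'a) quantale_scheme \<Rightarrow> ('q, 'm, 'b) qmodule_scheme \<Rightarrow> bool" where
  "quantale_module s Q M =
    (case s of Left_Side \<Rightarrow> left_quantale_module Q M | Right_Side \<Rightarrow> right_quantale_module Q M)"

definition qmodule_hom ::
    "('q, 'a) quantale_scheme \<Rightarrow> ('q, 'm, 'b) qmodule_scheme \<Rightarrow> ('q, 'n, 'c) qmodule_scheme
      \<Rightarrow> ('m \<Rightarrow> 'n) set" where
  "qmodule_hom Q M N = {f \<in> carrier M \<rightarrow> carrier N.
    (\<forall>A. A \<subseteq> carrier M \<longrightarrow> f (\<Squnion>\<^bsub>M\<^esub>A) = \<Squnion>\<^bsub>N\<^esub>(f ` A)) \<and>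
    (\<forall>q\<in>carrier Q. \<forall>m\<in>carrier M. f (q \<star>\<^bsub>M\<^esub> m) = q \<star>\<^bsub>N\<^esub> f m)}"

definition residual ::
    "('m, 'a) gorder_scheme \<Rightarrow> ('n, 'b) gorder_scheme \<Rightarrow> ('m \<Rightarrow> 'n) \<Rightarrow> 'n \<Rightarrow> 'm" where
  "residual M N f n = \<Squnion>\<^bsub>M\<^esub>{m \<in> carrier M. f m \<sqsubseteq>\<^bsub>N\<^esub> n}"

definition nucleus ::
    "('q, 'a) quantale_scheme \<Rightarrow> ('q, 'm, 'b) qmodule_scheme \<Rightarrow> ('m \<Rightarrow> 'm) \<Rightarrow> bool" where
  "nucleus Q M \<gamma> \<longleftrightarrow>
    \<gamma> \<in> carrier M \<rightarrow> carrier M \<and>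
    (\<forall>m\<in>carrier M. \<forall>n\<in>carrier M. m \<sqsubseteq>\<^bsub>M\<^esub> n \<longrightarrow> \<gamma> m \<sqsubseteq>\<^bsub>M\<^esub> \<gamma> n) \<and>
    (\<forall>m\<in>carrier M. m \<sqsubseteq>\<^bsub>M\<^esub> \<gamma> m) \<and>
    (\<forall>m\<in>carrier M. \<gamma> (\<gamma> m) = \<gamma> m) \<and>
    (\<forall>q\<in>carrier Q. \<forall>m\<in>carrier M. q \<star>\<^bsub>M\<^esub> \<gamma> m \<sqsubseteq>\<^bsub>M\<^esub> \<gamma> (q \<star>\<^bsub>M\<^esub> m))"

text \<open>The image of \<open>\<gamma>\<close> with the order inherited from \<open>M\<close>. Its joins and bottom are those of
  this order, which need not agree with the ones computed in \<open>M\<close>.\<close>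

definition nucleus_image ::
    "('q, 'm) qmodule \<Rightarrow> ('m \<Rightarrow> 'm) \<Rightarrow> ('q, 'm) qmodule" where
  "nucleus_image M \<gamma> =
    \<lparr>carrier = \<gamma> ` carrier M, eq = (=), le = le M, smult = (\<lambda>q m. \<gamma> (q \<star>\<^bsub>M\<^esub> m))\<rparr>"

end

theory Submission
  imports Defs
begin

text \<open>The homomorphism part is the adjunction of \<open>f\<close> and its residual. For the converse, the
  axioms of \<open>M\<^sub>\<gamma>\<close> come from those of \<open>M\<close> by applying \<open>\<gamma>\<close>, since an inner \<open>\<gamma>\<close> can be
  absorbed: \<open>\<gamma> (\<Squnion> (\<gamma> ` A)) = \<gamma> (\<Squnion> A)\<close> and \<open>\<gamma> (q \<star> \<gamma> m) = \<gamma> (q \<star> m)\<close>. The map \<open>f\<^sub>\<gamma>\<close> is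
  \<open>\<gamma>\<close> itself, whose residual is the inclusion of \<open>M\<^sub>\<gamma>\<close>.\<close>

section \<open>Joins, monotonicity and residuals in sup-lattices\<close>

context sup_lattice
begin

text \<open>\<open>\<Squnion>\<close> is a Hilbert choice among least upper bounds, so the existence
  axiom is what gives it meaning.\<close>

lemma sup_is_lub: "A \<subseteq> carrier L \<Longrightarrow> is_lub L (\<Squnion>A) A"
  unfolding sup_def by (rule someI_ex) (rule sup_exists)

lemma sup_closed: "A \<subseteq> carrier L \<Longrightarrow> \<Squnion>A \<in> carrier L"
  by (rule least_closed[OF sup_is_lub])

lemma sup_upper: "\<lbrakk>A \<subseteq> carrier L; x \<in> A\<rbrakk> \<Longrightarrow> x \<sqsubseteq> \<Squnion>A"
  by (rule least_Upper_above[OF sup_is_lub])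

lemma sup_least:
  "\<lbrakk>A \<subseteq> carrier L; y \<in> carrier L; \<And>x. x \<in> A \<Longrightarrow> x \<sqsubseteq> y\<rbrakk> \<Longrightarrow> \<Squnion>A \<sqsubseteq> y"
  by (rule least_le[OF sup_is_lub]) (auto intro: Upper_memI)

lemma sup_unique: "\<lbrakk>A \<subseteq> carrier L; is_lub L x A\<rbrakk> \<Longrightarrow> \<Squnion>A = x"
  using sup_is_lub least_unique by blast

lemma sup_eqI:
  "\<lbrakk>A \<subseteq> carrier L; s \<in> carrier L; \<And>x. x \<in> A \<Longrightarrow> x \<sqsubseteq> s;
    \<And>y. \<lbrakk>y \<in> carrier L; \<And>x. x \<in> A \<Longrightarrow> x \<sqsubseteq> y\<rbrakk> \<Longrightarrow> s \<sqsubseteq> y\<rbrakk> \<Longrightarrow> \<Squnion>A = s"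
  by (rule le_antisym) (simp_all add: sup_least sup_upper sup_closed)

text \<open>Encodes the order as a join, so that preservation of joins can yield
  monotonicity.\<close>

lemma sup_pair:
  assumes "x \<in> carrier L" "y \<in> carrier L" "x \<sqsubseteq> y"
  shows "\<Squnion>{x, y} = y"
  by (rule sup_eqI) (use assms in auto)

text \<open>Every element of the carrier bounds the empty family from above, so both choice terms
  pick from the same least elements.\<close>

lemma bottom_eq_sup: "\<bottom> = \<Squnion>{}"
  by (simp add: bottom_def sup_def)

text \<open>Applying \<open>f\<close> to \<open>\<Squnion>{x, y} = y\<close> shows that
  \<open>f y\<close> is the join of \<open>f x\<close> and \<open>f y\<close>.\<close>

lemma sup_preserving_mono:
  assumes N: "sup_lattice N" and f: "f \<in> carrier L \<rightarrow> carrier N"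
    and f_sup: "\<And>A. A \<subseteq> carrier L \<Longrightarrow> f (\<Squnion>A) = \<Squnion>\<^bsub>N\<^esub>(f ` A)"
    and xy: "x \<in> carrier L" "y \<in> carrier L" "x \<sqsubseteq> y"
  shows "f x \<sqsubseteq>\<^bsub>N\<^esub> f y"
proof -
  interpret N: sup_lattice N by (rule N)
  have "f x \<sqsubseteq>\<^bsub>N\<^esub> \<Squnion>\<^bsub>N\<^esub>{f x, f y}"
    using f xy by (intro N.sup_upper) auto
  also have "\<Squnion>\<^bsub>N\<^esub>{f x, f y} = f y"
    using f_sup[of "{x, y}"] xy by (simp add: sup_pair)
  finally show ?thesis .
qed

lemma residual_closed: "residual L N f n \<in> carrier L"
  unfolding residual_def by (rule sup_closed) auto

lemma residual_galois:
  assumes N: "sup_lattice N" and f: "f \<in> carrier L \<rightarrow> carrier N"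
    and f_sup: "\<And>A. A \<subseteq> carrier L \<Longrightarrow> f (\<Squnion>A) = \<Squnion>\<^bsub>N\<^esub>(f ` A)"
    and m: "m \<in> carrier L" and n: "n \<in> carrier N"
  shows "m \<sqsubseteq> residual L N f n \<longleftrightarrow> f m \<sqsubseteq>\<^bsub>N\<^esub> n"
proof
  interpret N: sup_lattice N by (rule N)
  let ?A = "{m \<in> carrier L. f m \<sqsubseteq>\<^bsub>N\<^esub> n}"
  have A: "?A \<subseteq> carrier L" by auto
  assume "m \<sqsubseteq> residual L N f n"
  then have "f m \<sqsubseteq>\<^bsub>N\<^esub> f (residual L N f n)"
    by (intro sup_preserving_mono[OF N f] f_sup m residual_closed)
  \<comment> \<open>Join preservation moves \<open>f\<close> inside the join defining the residual;
    every image there is below \<open>n\<close> by the choice of the family.\<close>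
  moreover have "f (residual L N f n) \<sqsubseteq>\<^bsub>N\<^esub> n"
    unfolding residual_def using f n by (subst f_sup[OF A], intro N.sup_least) auto
  ultimately show "f m \<sqsubseteq>\<^bsub>N\<^esub> n"
    by (rule N.le_trans) (use f m n residual_closed in \<open>auto intro!: funcset_mem[OF f]\<close>)
next
  assume "f m \<sqsubseteq>\<^bsub>N\<^esub> n"
  with m show "m \<sqsubseteq> residual L N f n"
    unfolding residual_def by (intro sup_upper) auto
qed

end

text \<open>A fixed scalar acts as a join-preserving map from \<open>M\<close> to itself, an
  instance of \<open>sup_preserving_mono\<close>.\<close>

lemma (in quantale_action) smult_mono:
  "\<lbrakk>q \<in> carrier Q; m \<in> carrier M; n \<in> carrier M; m \<sqsubseteq>\<^bsub>M\<^esub> n\<rbrakk> \<Longrightarrow> q \<star>\<^bsub>M\<^esub> m \<sqsubseteq>\<^bsub>M\<^esub> q \<star>\<^bsub>M\<^esub> n"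
  by (rule M.sup_preserving_mono[OF M.sup_lattice_axioms])
    (auto intro: smult_closed simp: smult_sup)

section \<open>From module homomorphisms to nuclei\<close>

lemma nucleus_residual_comp:
  assumes "quantale_action Q M" and "quantale_action Q N" and "f \<in> qmodule_hom Q M N"
  shows "nucleus Q M (residual M N f \<circ> f)"
proof -
  interpret QM: quantale_action Q M by (rule assms)
  interpret QN: quantale_action Q N by (rule assms)
  have f: "f \<in> carrier M \<rightarrow> carrier N"
    and f_sup: "\<And>A. A \<subseteq> carrier M \<Longrightarrow> f (\<Squnion>\<^bsub>M\<^esub>A) = \<Squnion>\<^bsub>N\<^esub>(f ` A)"
    and f_smult: "\<And>q m. \<lbrakk>q \<in> carrier Q; m \<in> carrier M\<rbrakk> \<Longrightarrow> f (q \<star>\<^bsub>M\<^esub> m) = q \<star>\<^bsub>N\<^esub> f m"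
    using assms(3) by (auto simp: qmodule_hom_def)
  note f_closed [simp] = Pi_mem[OF f]
  note [simp] = QM.M.residual_closed QM.smult_closed
  note galois = QM.M.residual_galois[OF QN.M.sup_lattice_axioms f f_sup]
  note f_mono = QM.M.sup_preserving_mono[OF QN.M.sup_lattice_axioms f f_sup]
  \<comment> \<open>Counit and unit arise from the adjunction by making one of its two inequalities
    reflexive.\<close>
  have counit: "f (residual M N f n) \<sqsubseteq>\<^bsub>N\<^esub> n" if "n \<in> carrier N" for n
    using that galois[of "residual M N f n" n] by simp
  have unit: "m \<sqsubseteq>\<^bsub>M\<^esub> residual M N f (f m)" if "m \<in> carrier M" for m
    using that galois[of m "f m"] by simp
  \<comment> \<open>By adjunction the goal becomes \<open>f (residual M N f (f m))\<close> below
    \<open>f n\<close>, which is the counit at \<open>f m\<close> followed by monotonicity of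
    \<open>f\<close>.\<close>
  have mono: "residual M N f (f m) \<sqsubseteq>\<^bsub>M\<^esub> residual M N f (f n)"
    if "m \<in> carrier M" "n \<in> carrier M" "m \<sqsubseteq>\<^bsub>M\<^esub> n" for m n
    using that galois[of "residual M N f (f m)" "f n"] counit[of "f m"] f_mono[of m n]
      QN.M.le_trans[of "f (residual M N f (f m))" "f m" "f n"] by simp
  \<comment> \<open>A triangle identity: one inequality is the counit at \<open>f m\<close>, the
    other is \<open>f\<close> applied to the unit. Taking residuals of both sides gives idempotence
    of the composite.\<close>
  have f_res_f: "f (residual M N f (f m)) = f m" if "m \<in> carrier M" for m
    using that unit f_mono[of m "residual M N f (f m)"] counit[of "f m"]
    by (intro QN.M.le_antisym) auto
  \<comment> \<open>Transposed along the adjunction, the left side becomes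
    \<open>q \<star> f (residual M N f (f m))\<close> by linearity, which \<open>f_res_f\<close>
    turns into \<open>q \<star> f m\<close>, that is \<open>f (q \<star> m)\<close>.\<close>
  have smult: "q \<star>\<^bsub>M\<^esub> residual M N f (f m) \<sqsubseteq>\<^bsub>M\<^esub> residual M N f (f (q \<star>\<^bsub>M\<^esub> m))"
    if "q \<in> carrier Q" "m \<in> carrier M" for q m
    using that f_smult f_res_f
      galois[of "q \<star>\<^bsub>M\<^esub> residual M N f (f m)" "f (q \<star>\<^bsub>M\<^esub> m)"] QN.smult_closed by simp
  show ?thesis
    unfolding nucleus_def using mono unit f_res_f smult by auto
qed

section \<open>The module of closed elements of a nucleus\<close>

locale module_nucleus = quantale_action Q M
  for Q :: "('q, 'a) quantale_scheme" (structure) and M :: "('q, 'm) qmodule" (structure) +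
  fixes \<gamma> :: "'m \<Rightarrow> 'm"
  assumes nucleus: "nucleus Q M \<gamma>"
begin

lemma nucleus_closed [simp]: "m \<in> carrier M \<Longrightarrow> \<gamma> m \<in> carrier M"
  and nucleus_mono: "\<lbrakk>m \<in> carrier M; n \<in> carrier M; m \<sqsubseteq>\<^bsub>M\<^esub> n\<rbrakk> \<Longrightarrow> \<gamma> m \<sqsubseteq>\<^bsub>M\<^esub> \<gamma> n"
  and nucleus_extensive: "m \<in> carrier M \<Longrightarrow> m \<sqsubseteq>\<^bsub>M\<^esub> \<gamma> m"
  and nucleus_idem [simp]: "m \<in> carrier M \<Longrightarrow> \<gamma> (\<gamma> m) = \<gamma> m"
  and smult_nucleus_le:
    "\<lbrakk>q \<in> carrier Q; m \<in> carrier M\<rbrakk> \<Longrightarrow> q \<star>\<^bsub>M\<^esub> \<gamma> m \<sqsubseteq>\<^bsub>M\<^esub> \<gamma> (q \<star>\<^bsub>M\<^esub> m)"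
  using nucleus by (auto simp: nucleus_def)

text \<open>The reflection property: extensivity gives one direction, monotonicity with idempotence
  the other. It lets an outer \<open>\<gamma>\<close> be dropped on the left of any inequality whose
  right side is closed.\<close>

lemma nucleus_le_iff:
  assumes "m \<in> carrier M" "n \<in> carrier M"
  shows "\<gamma> m \<sqsubseteq>\<^bsub>M\<^esub> \<gamma> n \<longleftrightarrow> m \<sqsubseteq>\<^bsub>M\<^esub> \<gamma> n"
  using assms nucleus_mono[of m "\<gamma> n"] nucleus_extensive[of m] M.le_trans[of m "\<gamma> m" "\<gamma> n"]
  by auto

text \<open>The nucleus inequality for scalars, closed up by \<open>nucleus_le_iff\<close>, gives
  one half; extensivity under the monotone action gives the other.\<close>

lemma nucleus_smult_nucleus:
  assumes "q \<in> carrier Q" "m \<in> carrier M"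
  shows "\<gamma> (q \<star>\<^bsub>M\<^esub> \<gamma> m) = \<gamma> (q \<star>\<^bsub>M\<^esub> m)"
proof (rule M.le_antisym)
  show "\<gamma> (q \<star>\<^bsub>M\<^esub> \<gamma> m) \<sqsubseteq>\<^bsub>M\<^esub> \<gamma> (q \<star>\<^bsub>M\<^esub> m)"
    using assms by (simp add: nucleus_le_iff smult_closed smult_nucleus_le)
  show "\<gamma> (q \<star>\<^bsub>M\<^esub> m) \<sqsubseteq>\<^bsub>M\<^esub> \<gamma> (q \<star>\<^bsub>M\<^esub> \<gamma> m)"
    using assms by (intro nucleus_mono smult_mono nucleus_extensive) (auto intro: smult_closed)
qed (use assms in \<open>simp_all add: smult_closed\<close>)

text \<open>Each \<open>\<gamma> a\<close> lies below the closed element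
  \<open>\<gamma> (\<Squnion> A)\<close>; conversely each \<open>a\<close> lies below
  \<open>\<gamma> a\<close>, hence below the join of the images.\<close>

lemma nucleus_sup_nucleus:
  assumes A: "A \<subseteq> carrier M"
  shows "\<gamma> (\<Squnion>\<^bsub>M\<^esub>(\<gamma> ` A)) = \<gamma> (\<Squnion>\<^bsub>M\<^esub>A)"
proof -
  have gA: "\<gamma> ` A \<subseteq> carrier M" using A by auto
  note [simp] = M.sup_closed[OF A] M.sup_closed[OF gA]
  show ?thesis
  proof (rule M.le_antisym)
    have "\<Squnion>\<^bsub>M\<^esub>(\<gamma> ` A) \<sqsubseteq>\<^bsub>M\<^esub> \<gamma> (\<Squnion>\<^bsub>M\<^esub>A)"
      using A gA by (intro M.sup_least) (auto intro: nucleus_mono M.sup_upper)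
    then show "\<gamma> (\<Squnion>\<^bsub>M\<^esub>(\<gamma> ` A)) \<sqsubseteq>\<^bsub>M\<^esub> \<gamma> (\<Squnion>\<^bsub>M\<^esub>A)"
      by (simp add: nucleus_le_iff)
    have "a \<sqsubseteq>\<^bsub>M\<^esub> \<Squnion>\<^bsub>M\<^esub>(\<gamma> ` A)" if "a \<in> A" for a
      using that A gA M.le_trans[OF nucleus_extensive M.sup_upper[OF gA]] by auto
    then show "\<gamma> (\<Squnion>\<^bsub>M\<^esub>A) \<sqsubseteq>\<^bsub>M\<^esub> \<gamma> (\<Squnion>\<^bsub>M\<^esub>(\<gamma> ` A))"
      using A by (intro nucleus_mono M.sup_least) auto
  qed simp_all
qed

abbreviation M\<^sub>\<gamma> :: "('q, 'm) qmodule" where "M\<^sub>\<gamma> \<equiv> nucleus_image M \<gamma>"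

lemma nucleus_image_simps [simp]:
  "carrier M\<^sub>\<gamma> = \<gamma> ` carrier M" "eq M\<^sub>\<gamma> = (=)" "le M\<^sub>\<gamma> = le M"
  "smult M\<^sub>\<gamma> q m = \<gamma> (q \<star>\<^bsub>M\<^esub> m)"
  by (simp_all add: nucleus_image_def)

lemma nucleus_image_subset: "A \<subseteq> \<gamma> ` carrier M \<Longrightarrow> A \<subseteq> carrier M"
  by auto

lemma nucleus_image_memD: "m \<in> \<gamma> ` carrier M \<Longrightarrow> m \<in> carrier M"
  by auto

lemma nucleus_image_is_lub:
  assumes A: "A \<subseteq> carrier M\<^sub>\<gamma>"
  shows "is_lub M\<^sub>\<gamma> (\<gamma> (\<Squnion>\<^bsub>M\<^esub>A)) A"
proof (rule least_UpperI)
  have AM: "A \<subseteq> carrier M" using A by (simp add: nucleus_image_subset)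
  note [simp] = M.sup_closed[OF AM]
  show "x \<sqsubseteq>\<^bsub>M\<^sub>\<gamma>\<^esub> \<gamma> (\<Squnion>\<^bsub>M\<^esub>A)" if "x \<in> A" for x
    using that AM M.le_trans[OF M.sup_upper[OF AM that] nucleus_extensive] by auto
  show "\<gamma> (\<Squnion>\<^bsub>M\<^esub>A) \<sqsubseteq>\<^bsub>M\<^sub>\<gamma>\<^esub> y" if y: "y \<in> Upper M\<^sub>\<gamma> A" for y
  proof -
    \<comment> \<open>An upper bound inside the image is closed, so being above the join in
      \<open>M\<close> already puts it above the closure of that join.\<close>
    obtain m where m: "m \<in> carrier M" "y = \<gamma> m"
      using y by (auto simp: Upper_def)
    have "\<Squnion>\<^bsub>M\<^esub>A \<sqsubseteq>\<^bsub>M\<^esub> \<gamma> m"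
      using y A AM m by (intro M.sup_least) (auto simp: Upper_def)
    with m show ?thesis by (simp add: nucleus_le_iff)
  qed
  show "\<gamma> (\<Squnion>\<^bsub>M\<^esub>A) \<in> carrier M\<^sub>\<gamma>" by simp
qed (rule A)

lemma sup_lattice_nucleus_image: "sup_lattice M\<^sub>\<gamma>"
proof unfold_locales
  show "x \<sqsubseteq>\<^bsub>M\<^sub>\<gamma>\<^esub> z"
    if "x \<sqsubseteq>\<^bsub>M\<^sub>\<gamma>\<^esub> y" "y \<sqsubseteq>\<^bsub>M\<^sub>\<gamma>\<^esub> z" "x \<in> carrier M\<^sub>\<gamma>" "y \<in> carrier M\<^sub>\<gamma>" "z \<in> carrier M\<^sub>\<gamma>" for x y z
    using that by (auto intro: M.le_trans)
  show "x .=\<^bsub>M\<^sub>\<gamma>\<^esub> y"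
    if "x \<sqsubseteq>\<^bsub>M\<^sub>\<gamma>\<^esub> y" "y \<sqsubseteq>\<^bsub>M\<^sub>\<gamma>\<^esub> x" "x \<in> carrier M\<^sub>\<gamma>" "y \<in> carrier M\<^sub>\<gamma>" for x y
    using that by auto
  show "\<exists>s. is_lub M\<^sub>\<gamma> s A" if "A \<subseteq> carrier M\<^sub>\<gamma>" for A
    using nucleus_image_is_lub[OF that] by blast
qed auto

lemma nucleus_image_sup: "A \<subseteq> carrier M\<^sub>\<gamma> \<Longrightarrow> \<Squnion>\<^bsub>M\<^sub>\<gamma>\<^esub>A = \<gamma> (\<Squnion>\<^bsub>M\<^esub>A)"
  by (rule sup_lattice.sup_unique[OF sup_lattice_nucleus_image _ nucleus_image_is_lub])

text \<open>The case of the empty family, with both bottoms read as empty joins.\<close>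

lemma nucleus_image_bottom: "\<bottom>\<^bsub>M\<^sub>\<gamma>\<^esub> = \<gamma> \<bottom>\<^bsub>M\<^esub>"
  using nucleus_image_sup[of "{}"]
  by (simp add: M.bottom_eq_sup sup_lattice.bottom_eq_sup[OF sup_lattice_nucleus_image])

text \<open>Serves twice: as join preservation of \<open>\<gamma>\<close> into
  \<open>M\<^sub>\<gamma>\<close>, and to carry \<open>\<gamma>\<close> inside joins when the
  distributive laws are transferred.\<close>

lemma nucleus_sup:
  assumes "A \<subseteq> carrier M"
  shows "\<gamma> (\<Squnion>\<^bsub>M\<^esub>A) = \<Squnion>\<^bsub>M\<^sub>\<gamma>\<^esub>(\<gamma> ` A)"
  using assms nucleus_image_sup[of "\<gamma> ` A"] nucleus_sup_nucleus[of A]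
  by (simp add: image_mono)

lemma quantale_action_nucleus_image: "quantale_action Q M\<^sub>\<gamma>"
proof (intro quantale_action.intro quantale_action_axioms.intro)
  show "q \<star>\<^bsub>M\<^sub>\<gamma>\<^esub> m \<in> carrier M\<^sub>\<gamma>" if "q \<in> carrier Q" "m \<in> carrier M\<^sub>\<gamma>" for q m
    using that by (auto intro!: smult_closed)
  show "(\<Squnion>\<^bsub>Q\<^esub>A) \<star>\<^bsub>M\<^sub>\<gamma>\<^esub> m = \<Squnion>\<^bsub>M\<^sub>\<gamma>\<^esub>((\<lambda>q. q \<star>\<^bsub>M\<^sub>\<gamma>\<^esub> m) ` A)"
    if "A \<subseteq> carrier Q" "m \<in> carrier M\<^sub>\<gamma>" for A m
  proof -
    have m: "m \<in> carrier M" using that by auto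
    have "(\<lambda>q. q \<star>\<^bsub>M\<^esub> m) ` A \<subseteq> carrier M" using that m by (auto intro: smult_closed)
    then show ?thesis
      using that m by (simp add: sup_smult nucleus_sup image_image)
  qed
  show "q \<star>\<^bsub>M\<^sub>\<gamma>\<^esub> (\<Squnion>\<^bsub>M\<^sub>\<gamma>\<^esub>B) = \<Squnion>\<^bsub>M\<^sub>\<gamma>\<^esub>((\<lambda>m. q \<star>\<^bsub>M\<^sub>\<gamma>\<^esub> m) ` B)"
    if "q \<in> carrier Q" "B \<subseteq> carrier M\<^sub>\<gamma>" for q B
  proof -
    have B: "B \<subseteq> carrier M" using that by (simp add: nucleus_image_subset)
    have qB: "(\<lambda>m. q \<star>\<^bsub>M\<^esub> m) ` B \<subseteq> carrier M" using that B by (auto intro: smult_closed)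
    \<comment> \<open>The join in \<open>M\<^sub>\<gamma>\<close> contributes an inner
      \<open>\<gamma>\<close>, which the outer one absorbs; distributivity in \<open>M\<close> then
      applies.\<close>
    have "q \<star>\<^bsub>M\<^sub>\<gamma>\<^esub> (\<Squnion>\<^bsub>M\<^sub>\<gamma>\<^esub>B) = \<gamma> (q \<star>\<^bsub>M\<^esub> \<Squnion>\<^bsub>M\<^esub>B)"
      using that B by (simp add: nucleus_image_sup nucleus_smult_nucleus M.sup_closed)
    then show ?thesis
      using that B qB by (simp add: smult_sup nucleus_sup image_image)
  qed
  \<comment> \<open>Here \<open>m\<close> is some \<open>\<gamma> n\<close>: the unit law in
    \<open>M\<close> removes the scalar, and idempotence the extra \<open>\<gamma>\<close>.\<close>
  show "qunit Q \<star>\<^bsub>M\<^sub>\<gamma>\<^esub> m = m" if "m \<in> carrier M\<^sub>\<gamma>" for m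
    using that by (auto simp: smult_unit)
qed (rule Q.quantale_axioms sup_lattice_nucleus_image)+

lemma nucleus_hom: "\<gamma> \<in> qmodule_hom Q M M\<^sub>\<gamma>"
  by (auto simp: qmodule_hom_def nucleus_sup nucleus_smult_nucleus)

text \<open>By \<open>nucleus_le_iff\<close> the family joined by the residual is the down-set of
  \<open>\<gamma> m\<close> in \<open>M\<close>, which has \<open>\<gamma> m\<close> as its greatest
  element.\<close>

lemma residual_nucleus:
  assumes "m \<in> carrier M"
  shows "residual M M\<^sub>\<gamma> \<gamma> (\<gamma> m) = \<gamma> m"
  unfolding residual_def
  by (rule M.sup_eqI) (use assms in \<open>auto simp: nucleus_le_iff\<close>)

text \<open>On either side, the iterated product carries one inner \<open>\<gamma>\<close>; once it
  is absorbed, the law is \<open>\<gamma>\<close> applied to associativity in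
  \<open>M\<close>.\<close>

lemma quantale_module_nucleus_image:
  assumes "quantale_module s Q M"
  shows "quantale_module s Q M\<^sub>\<gamma>"
proof (cases s)
  case Left_Side
  then interpret left_quantale_module Q M
    using assms by (simp add: quantale_module_def)
  have "left_quantale_module Q M\<^sub>\<gamma>"
    by (intro left_quantale_module.intro left_quantale_module_axioms.intro
        quantale_action_nucleus_image)
      (simp_all add: smult_assoc nucleus_smult_nucleus smult_closed nucleus_image_memD)
  with Left_Side show ?thesis by (simp add: quantale_module_def)
next
  case Right_Side
  then interpret right_quantale_module Q M
    using assms by (simp add: quantale_module_def)
  have "right_quantale_module Q M\<^sub>\<gamma>"
    by (intro right_quantale_module.intro right_quantale_module_axioms.intro
        quantale_action_nucleus_image)
      (simp_all add: smult_assoc nucleus_smult_nucleus smult_closed nucleus_image_memD)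
  with Right_Side show ?thesis by (simp add: quantale_module_def)
qed

end

text \<open>Passes from the sided predicate to the common locale, so that the nucleus facts serve
  left and right modules at once.\<close>

lemma quantale_module_action: "quantale_module s Q M \<Longrightarrow> quantale_action Q M"
  by (auto simp: quantale_module_def left_quantale_module_def right_quantale_module_def
      split: side.splits)

theorem theorem4p3p3:
  fixes Q :: "'q quantale" and M :: "('q, 'm) qmodule" and s :: side
  assumes "quantale Q" and "quantale_module s Q M"
  shows "(\<forall>(N :: ('q, 'n) qmodule) f.
            quantale_module s Q N \<longrightarrow> f \<in> qmodule_hom Q M N \<longrightarrow>
              nucleus Q M (residual M N f \<circ> f)) \<and>
         (\<forall>\<gamma>. nucleus Q M \<gamma> \<longrightarrow>
            quantale_module s Q (nucleus_image M \<gamma>) \<and>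
            (\<forall>A. A \<subseteq> carrier (nucleus_image M \<gamma>) \<longrightarrow>
              \<Squnion>\<^bsub>nucleus_image M \<gamma>\<^esub>A = \<gamma> (\<Squnion>\<^bsub>M\<^esub>A)) \<and>
            \<bottom>\<^bsub>nucleus_image M \<gamma>\<^esub> = \<gamma> \<bottom>\<^bsub>M\<^esub> \<and>
            (\<exists>f\<^sub>\<gamma> \<in> qmodule_hom Q M (nucleus_image M \<gamma>).
              \<forall>m\<in>carrier M. (residual M (nucleus_image M \<gamma>) f\<^sub>\<gamma> \<circ> f\<^sub>\<gamma>) m = \<gamma> m))"
proof (intro conjI allI impI)
  have action: "quantale_action Q M"
    using assms(2) by (rule quantale_module_action)
  show "nucleus Q M (residual M N f \<circ> f)"
    if "quantale_module s Q N" "f \<in> qmodule_hom Q M N" for N :: "('q, 'n) qmodule" and f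
    using action quantale_module_action[OF that(1)] that(2) by (rule nucleus_residual_comp)
  fix \<gamma>
  assume "nucleus Q M \<gamma>"
  with action interpret module_nucleus Q M \<gamma>
    by (simp add: module_nucleus_def module_nucleus_axioms_def)
  show "quantale_module s Q (nucleus_image M \<gamma>)"
    using assms(2) by (rule quantale_module_nucleus_image)
  show "\<Squnion>\<^bsub>nucleus_image M \<gamma>\<^esub>A = \<gamma> (\<Squnion>\<^bsub>M\<^esub>A)" if "A \<subseteq> carrier (nucleus_image M \<gamma>)" for A
    using that by (rule nucleus_image_sup)
  show "\<bottom>\<^bsub>nucleus_image M \<gamma>\<^esub> = \<gamma> \<bottom>\<^bsub>M\<^esub>"
    by (rule nucleus_image_bottom)
  show "\<exists>f\<^sub>\<gamma> \<in> qmodule_hom Q M (nucleus_image M \<gamma>).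
      \<forall>m\<in>carrier M. (residual M (nucleus_image M \<gamma>) f\<^sub>\<gamma> \<circ> f\<^sub>\<gamma>) m = \<gamma> m"
    using nucleus_hom residual_nucleus by auto
qed

end
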